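(* Let $S$ be a complete separable metric space with its Borel $\sigma$-algebra, and let $P=(P(x,dy):x,y\in S)$ be the one-step transition kernel of a Markov chain on $S$ having a unique stationary distribution $\pi$. Suppose that: (i) there exist a (measurable) coercive function $r:S\to\mathbb{R}_+$, a continuous function $g:S\to\mathbb{R}_+$, and a constant $b<\infty$ for which $$\int_S P(x,dy)\,g(y)\le g(x)-r(x)+b\qquad\text{for all }x\in S;$$ (ii) $P$ is weakly continuous: for every bounded continuous function $f:S\to\mathbb{R}$, the function $x\mapsto\int_S f(y)P(x,dy)$ is bounded and continuous on $S$. Put $A_n=K_n(g)=\{x\in S:g(x)\le n\}$ for $n\ge1$, let $P_n$ be a general augmentation of $P$ on $A_n$ for each $n\geq 1$, and suppose that the set $\Pi_n$ of stationary distributions of $P_n$ is non-empty for each $n\ge1$. If $\pi_n\in\Pi_n$ for each $n\geq 1$, then $$\pi_n\Rightarrow\pi\qquad\text{as }n\to\infty,$$ where $\Rightarrow$ denotes weak convergence of probabilities on $S$.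
   Context: A function $f:S\to\mathbb{R}_+$ on the metric space $S$ is coercive if for each $n\ge1$ the sublevel set $K_n(f)=\{x\in S:f(x)\le n\}$ is either empty or compact. A general augmentation of $P$ on $A_n$ is a stochastic kernel $P_n=(P_n(x,dy):x,y\in A_n)$ on $A_n$ such that $P_n(x,B)\ge P(x,B)$ for all $x\in A_n$ and all measurable $B\subseteq A_n$. $\Pi_n$ is the set of probabilities $\pi_n$ on $A_n$ with $\pi_n(B)=\int_{A_n}\pi_n(dx)P_n(x,B)$ for all measurable $B\subseteq A_n$; each such $\pi_n$ is regarded as a probability on $S$ that assigns mass $0$ to $A_n^c$. *)

theory Defs
  imports "HOL-Probability.Probability"
begin

definition sublevel :: "('a \<Rightarrow> real) \<Rightarrow> nat \<Rightarrow> 'a set" where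
  "sublevel f n = {x. f x \<le> real n}"

definition coercive :: "('a::metric_space \<Rightarrow> real) \<Rightarrow> bool" where
  "coercive f \<longleftrightarrow>
     (\<forall>x. 0 \<le> f x) \<and> (\<forall>n\<ge>1. sublevel f n = {} \<or> compact (sublevel f n))"

definition stochastic_kernel :: "'a measure \<Rightarrow> ('a \<Rightarrow> 'a measure) \<Rightarrow> bool" where
  "stochastic_kernel M K \<longleftrightarrow> K \<in> M \<rightarrow>\<^sub>M prob_algebra M"

definition stationary_distributions ::
    "'a measure \<Rightarrow> ('a \<Rightarrow> 'a measure) \<Rightarrow> 'a measure set" where
  "stationary_distributions M K =
     {\<mu> \<in> space (prob_algebra M).
        \<forall>B\<in>sets M. emeasure \<mu> B = (\<integral>\<^sup>+x. emeasure (K x) B \<partial>\<mu>)}"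

definition weakly_continuous_kernel :: "('a::metric_space \<Rightarrow> 'a measure) \<Rightarrow> bool" where
  "weakly_continuous_kernel K \<longleftrightarrow>
     (\<forall>f::'a \<Rightarrow> real. continuous_on UNIV f \<and> bounded (range f) \<longrightarrow>
        continuous_on UNIV (\<lambda>x. \<integral>y. f y \<partial>K x) \<and>
        bounded (range (\<lambda>x. \<integral>y. f y \<partial>K x)))"

text \<open>Measures on a subset \<open>A\<close> live on the trace \<open>\<sigma>\<close>-algebra, i.e. on
  \<^term>\<open>restrict_space borel A\<close>. When \<open>A\<close> is Borel (as for sublevel sets of a continuous
  function), its measurable sets are exactly the Borel sets contained in \<open>A\<close>.\<close>

definition general_augmentation ::
    "('a::metric_space \<Rightarrow> 'a measure) \<Rightarrow> 'a set \<Rightarrow> ('a \<Rightarrow> 'a measure) \<Rightarrow> bool" where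
  "general_augmentation P A Q \<longleftrightarrow>
     stochastic_kernel (restrict_space borel A) Q \<and>
     (\<forall>x\<in>A. \<forall>B\<in>sets (restrict_space borel A). emeasure (P x) B \<le> emeasure (Q x) B)"

text \<open>A measure on \<open>A\<close> regarded as a measure on the whole space, giving mass \<open>0\<close> to the
  complement of \<open>A\<close>: the image measure under the inclusion map.\<close>

definition extend_measure_zero :: "'a::metric_space measure \<Rightarrow> 'a measure" where
  "extend_measure_zero \<mu> = distr \<mu> borel (\<lambda>x. x)"

text \<open>The notion \<^const>\<open>weak_conv_m\<close> of the library is specific to the real line.\<close>

definition converges_weakly ::
    "(nat \<Rightarrow> 'a::metric_space measure) \<Rightarrow> 'a measure \<Rightarrow> bool" where
  "converges_weakly \<mu>s \<mu> \<longleftrightarrow>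
     (\<forall>f::'a \<Rightarrow> real. continuous_on UNIV f \<and> bounded (range f) \<longrightarrow>
        (\<lambda>n. \<integral>x. f x \<partial>\<mu>s n) \<longlonglongrightarrow> (\<integral>x. f x \<partial>\<mu>))"

end

theory Submission
  imports Defs
begin

text \<open>
  On \<open>A\<^sub>n = {g \<le> n}\<close> an augmentation only moves the mass escaping from \<open>A\<^sub>n\<close>, where \<open>g > n\<close>, back to
  points with \<open>g \<le> n\<close>; so the drift inequality survives for \<open>P\<^sub>n\<close>, and integrating it against
  \<open>\<pi>\<^sub>n\<close> bounds \<open>\<integral> r d\<pi>\<^sub>n\<close> uniformly in \<open>n\<close>. As \<open>r\<close> is coercive, \<open>(\<pi>\<^sub>n)\<close> is tight. By Markov's
  inequality \<open>P x (- A\<^sub>n) \<le> (g x + b) / n\<close>, which tends to \<open>0\<close> uniformly on compact sets; with weak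
  continuity every weak cluster point \<open>\<mu>\<close> of \<open>(\<pi>\<^sub>n)\<close> satisfies \<open>\<integral> P f d\<mu> \<le> \<integral> f d\<mu>\<close> for continuous
  \<open>0 \<le> f \<le> 1\<close>. Replacing \<open>f\<close> by \<open>1 - f\<close> gives equality, so \<open>\<mu>\<close> is stationary and equals \<open>\<pi>\<close>.

  Prokhorov's theorem is obtained with filters instead of subsequences. By Tychonoff, along some
  finer filter the integrals of all bounded Borel functions converge simultaneously. The limits
  on indicators form a finitely additive tight set function \<open>m\<close>. Taking the supremum of \<open>m\<close> over
  compact subsets of an open set and then the infimum over open supersets yields an outer measure
  whose restriction \<open>\<mu>\<close> to the Borel sets is a probability measure with \<open>\<mu> U \<le> m U\<close> for open \<open>U\<close>,
  and this is one half of the portmanteau theorem.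
\<close>

section \<open>Measures from tight finitely additive set functions\<close>

text \<open>Around each point of \<open>K\<close> some closed ball fits into a single
  \<open>U i\<close>, and finitely many of the open balls cover \<open>K\<close>. The closed balls
  assigned to the same index, cut down to \<open>K\<close>, form one compact piece. This is what
  upgrades finite subadditivity on compact sets to countable subadditivity on open sets.\<close>

lemma compact_subset_Union_shrink:
  fixes K :: "'a::metric_space set"
  assumes "compact K" and "\<And>i. i \<in> I \<Longrightarrow> open (U i)" and "K \<subseteq> (\<Union>i\<in>I. U i)"
  obtains J C where "finite J" "J \<subseteq> I" "\<And>i. i \<in> J \<Longrightarrow> compact (C i)"
    "\<And>i. i \<in> J \<Longrightarrow> C i \<subseteq> U i" "K = (\<Union>i\<in>J. C i)"
proof -
  have "\<exists>i e. i \<in> I \<and> 0 < e \<and> cball x e \<subseteq> U i" if "x \<in> K" for x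
  proof -
    from that assms(3) obtain i where i: "i \<in> I" "x \<in> U i"
      by blast
    with open_contains_cball assms(2) show ?thesis
      by blast
  qed
  then obtain i e where ie: "\<And>x. x \<in> K \<Longrightarrow> i x \<in> I" "\<And>x. x \<in> K \<Longrightarrow> 0 < e x"
    "\<And>x. x \<in> K \<Longrightarrow> cball x (e x) \<subseteq> U (i x)"
    by metis
  have "K \<subseteq> (\<Union>x\<in>K. ball x (e x))"
    using ie(2) centre_in_ball by blast
  then obtain F where F: "F \<subseteq> K" "finite F" "K \<subseteq> (\<Union>x\<in>F. ball x (e x))"
    by (rule compactE_image[OF \<open>compact K\<close>, rotated]) auto
  define C where "C j = K \<inter> (\<Union>x\<in>{x\<in>F. i x = j}. cball x (e x))" for j
  show thesis
  proof (rule that[of "i ` F" C])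
    show "finite (i ` F)" "i ` F \<subseteq> I" using F ie(1) by auto
    show "compact (C j)" for j
      unfolding C_def using F(2) \<open>compact K\<close> by (intro compact_Int_closed closed_UN) auto
    show "C j \<subseteq> U j" for j
      unfolding C_def using F(1) ie(3) by blast
    show "K = (\<Union>j\<in>i ` F. C j)"
    proof (intro subset_antisym subsetI)
      fix x assume "x \<in> K"
      with F(3) obtain y where "y \<in> F" "x \<in> ball y (e y)" by blast
      with \<open>x \<in> K\<close> show "x \<in> (\<Union>j\<in>i ` F. C j)"
        unfolding C_def using ball_subset_cball by blast
    qed (auto simp: C_def)
  qed
qed

text \<open>Open sets are tested by their compact subsets only, so compactness turns countable
  covers into finite ones and makes up for the countable additivity that \<open>m\<close> may lack.
  Individual sets can lose mass in this way, whence a mere upper bound on open sets in the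
  conclusion; \<open>tight\<close> keeps the total mass at 1.\<close>

lemma finitely_additive_tight_imp_measure:
  fixes m :: "'a::metric_space set \<Rightarrow> real"
  assumes nonneg: "\<And>A. A \<in> sets borel \<Longrightarrow> 0 \<le> m A"
    and add: "\<And>A B. A \<in> sets borel \<Longrightarrow> B \<in> sets borel \<Longrightarrow> A \<inter> B = {} \<Longrightarrow> m (A \<union> B) = m A + m B"
    and total: "m UNIV = 1"
    and tight: "\<And>e. 0 < e \<Longrightarrow> \<exists>K. compact K \<and> m (- K) \<le> e"
  obtains \<mu> where "sets \<mu> = sets borel" "prob_space \<mu>"
    "\<And>U. open U \<Longrightarrow> emeasure \<mu> U \<le> ennreal (m U)"
proof -
  have [simp]: "K \<in> sets borel" if "compact K" for K :: "'a set"
    using that by (intro borel_closed compact_imp_closed)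

  \<comment> \<open>Monotonicity and finite subadditivity of \<open>m\<close>\<close>
  have m0: "m {} = 0"
    using add[of "{}" "{}"] by simp
  have mono: "m A \<le> m B" if "A \<in> sets borel" "B \<in> sets borel" "A \<subseteq> B" for A B
  proof -
    have "m (A \<union> (B - A)) = m A + m (B - A)"
      using that by (intro add) auto
    with that nonneg[of "B - A"] show ?thesis
      by (simp add: Un_absorb1)
  qed
  have subadd: "m (A \<union> B) \<le> m A + m B" if "A \<in> sets borel" "B \<in> sets borel" for A B
  proof -
    have "m (A \<union> (B - A)) = m A + m (B - A)"
      using that by (intro add) auto
    with that mono[of "B - A" B] show ?thesis
      by simp
  qed
  have fin_subadd: "m (\<Union>i\<in>J. C i) \<le> (\<Sum>i\<in>J. m (C i))"
    if "finite J" "\<And>i. i \<in> J \<Longrightarrow> C i \<in> sets borel" for J :: "nat set" and C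
    using that
  proof (induction J)
    case (insert j J)
    then have "m (C j \<union> (\<Union>i\<in>J. C i)) \<le> m (C j) + m (\<Union>i\<in>J. C i)"
      by (intro subadd) auto
    with insert show ?case by fastforce
  qed (simp add: m0)

  \<comment> \<open>Inner approximation of open sets and outer approximation of all sets\<close>
  define l where "l U = (SUP K\<in>{K. compact K \<and> K \<subseteq> U}. ennreal (m K))" for U
  define \<phi> where "\<phi> A = (INF U\<in>{U. open U \<and> A \<subseteq> U}. l U)" for A
  have l_upper: "ennreal (m K) \<le> l U" if "compact K" "K \<subseteq> U" for K U
    unfolding l_def using that by (intro SUP_upper) auto
  have l_le: "l U \<le> ennreal (m U)" if "open U" for U
    unfolding l_def using that by (intro SUP_least ennreal_leI mono) auto
  have l_mono: "l U \<le> l V" if "U \<subseteq> V" for U V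
    unfolding l_def using that by (intro SUP_subset_mono) auto
  have l_approx: "\<exists>K. compact K \<and> K \<subseteq> U \<and> l U \<le> ennreal (m K) + ennreal e"
    if "0 < e" "open U" for U e
  proof (rule ccontr)
    assume *: "\<not> ?thesis"
    \<comment> \<open>If no compact subset came within \<open>e\<close> of the supremum, then
      \<open>l U + e\<close> would be at most \<open>l U\<close>, which finiteness of
      \<open>l U\<close> forbids.\<close>
    have "l U < \<top>"
      using l_le[OF that(2)] by (simp add: order_le_less_trans)
    have "ennreal (m K) + ennreal e \<le> l U" if "compact K" "K \<subseteq> U" for K
      using * that by (meson linear)
    then have "(SUP K\<in>{K. compact K \<and> K \<subseteq> U}. ennreal (m K) + ennreal e) \<le> l U"
      by (intro SUP_least) auto
    then have "l U + ennreal e \<le> l U"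
      unfolding l_def by (subst ennreal_SUP_add_left[symmetric]) auto
    moreover have "l U < l U + ennreal e"
      using \<open>l U < \<top>\<close> \<open>0 < e\<close> by (simp add: ennreal_add_left_cancel_less[of _ 0, simplified])
    ultimately show False by simp
  qed
  have l_Union: "l (\<Union>i. U i) \<le> (\<Sum>i. l (U i))" if op: "\<And>i. open (U i)" for U :: "nat \<Rightarrow> 'a set"
    unfolding l_def[of "\<Union>i. U i"]
  \<comment> \<open>A compact subset of the union splits into finitely many compact pieces, each
    inside one \<open>U i\<close>, so \<open>fin_subadd\<close> suffices.\<close>
  proof (rule SUP_least, clarify)
    fix K assume K: "compact K" "K \<subseteq> (\<Union>i. U i)"
    obtain J C where JC: "finite J" "\<And>i. i \<in> J \<Longrightarrow> compact (C i)"
      "\<And>i. i \<in> J \<Longrightarrow> C i \<subseteq> U i" "K = (\<Union>i\<in>J. C i)"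
      by (rule compact_subset_Union_shrink[OF K(1) _ K(2)]) (use op in auto)
    have "m K \<le> (\<Sum>i\<in>J. m (C i))"
      unfolding JC(4) using JC by (intro fin_subadd) auto
    then have "ennreal (m K) \<le> ennreal (\<Sum>i\<in>J. m (C i))"
      by (rule ennreal_leI)
    also have "\<dots> = (\<Sum>i\<in>J. ennreal (m (C i)))"
      using JC by (intro sum_ennreal[symmetric]) (auto intro: nonneg)
    also have "\<dots> \<le> (\<Sum>i\<in>J. l (U i))"
      using JC by (intro sum_mono l_upper) auto
    also have "\<dots> \<le> (\<Sum>i. l (U i))"
      using JC(1) by (intro sum_le_suminf) auto
    finally show "ennreal (m K) \<le> (\<Sum>i. l (U i))" .
  qed
  have \<phi>_open: "\<phi> U = l U" if "open U" for U
    unfolding \<phi>_def using that l_mono by (intro antisym INF_greatest INF_lower) auto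
  have \<phi>_mono: "\<phi> A \<le> \<phi> B" if "A \<subseteq> B" for A B
    unfolding \<phi>_def using that by (intro INF_superset_mono) auto
  have l_fin: "l U < \<top>" if "open U" for U
    using l_le[OF that] by (simp add: order_le_less_trans)
  have \<phi>_fin: "\<phi> A < \<top>" for A
    using \<phi>_mono[of A UNIV] l_fin[of UNIV] by (simp add: \<phi>_open order_le_less_trans)
  have \<phi>_approx: "\<exists>U. open U \<and> A \<subseteq> U \<and> l U \<le> \<phi> A + ennreal e" if "0 < e" for A e
  proof -
    have "\<phi> A < \<phi> A + ennreal e"
      using \<phi>_fin[of A] \<open>0 < e\<close> by (simp add: ennreal_add_left_cancel_less[of _ 0, simplified])
    then show ?thesis
      unfolding \<phi>_def[of A] INF_less_iff by (auto intro: less_imp_le)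
  qed

  \<comment> \<open>The outer measure property\<close>
  have "outer_measure_space UNIV \<phi>"
    unfolding outer_measure_space_def
  proof (intro conjI)
    have "l {} \<le> 0"
      using l_le[of "{}"] m0 by simp
    then show "positive UNIV \<phi>"
      by (simp add: positive_def \<phi>_open)
    show "increasing UNIV \<phi>"
      by (simp add: increasing_def \<phi>_mono)
    show "countably_subadditive UNIV \<phi>"
      unfolding countably_subadditive_def
    proof clarify
      fix A :: "nat \<Rightarrow> 'a set"
      show "\<phi> (\<Union>i. A i) \<le> (\<Sum>i. \<phi> (A i))"
      proof (rule ennreal_le_epsilon)
        fix e :: real assume "0 < e"
        then have "\<exists>U. open U \<and> A i \<subseteq> U \<and> l U \<le> \<phi> (A i) + ennreal (e * (1/2)^Suc i)" for i
          by (intro \<phi>_approx) auto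
        then obtain U where U: "\<And>i. open (U i)" "\<And>i. A i \<subseteq> U i"
          "\<And>i. l (U i) \<le> \<phi> (A i) + ennreal (e * (1/2)^Suc i)"
          by metis
        have "\<phi> (\<Union>i. A i) \<le> \<phi> (\<Union>i. U i)"
          using U(2) by (intro \<phi>_mono) auto
        also have "\<dots> \<le> (\<Sum>i. l (U i))"
          using U(1) by (subst \<phi>_open) (auto intro: l_Union)
        also have "\<dots> \<le> (\<Sum>i. \<phi> (A i) + ennreal (e * (1/2)^Suc i))"
          using U(3) by (intro suminf_le) auto
        also have "\<dots> = (\<Sum>i. \<phi> (A i)) + (\<Sum>i. ennreal (e * (1/2)^Suc i))"
          by (rule suminf_add[symmetric]) auto
        also have "(\<Sum>i. ennreal (e * (1/2)^Suc i)) = ennreal e"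
          using \<open>0 < e\<close> sums_mult[OF power_half_series, of e]
          by (subst suminf_ennreal2) (auto simp: sums_iff)
        finally show "\<phi> (\<Union>i. A i) \<le> (\<Sum>i. \<phi> (A i)) + ennreal e" .
      qed
    qed
  qed

  \<comment> \<open>Caratheodory measurability of open sets\<close>
  interpret P: sigma_algebra UNIV "UNIV :: 'a set set"
    using sigma_algebra_Pow[of UNIV] by simp
  let ?L = "lambda_system UNIV UNIV \<phi>"
  have ms: "measure_space UNIV ?L \<phi>"
    by (rule P.caratheodory_lemma) fact
  have "open U \<Longrightarrow> U \<in> ?L" for U
    unfolding P.lambda_system_eq
  proof (clarsimp, rule antisym)
    fix A assume U: "open U"
    have sub: "\<phi> (X \<union> Y) \<le> \<phi> X + \<phi> Y" for X Y
    proof -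
      have "subadditive UNIV \<phi>"
        using \<open>outer_measure_space UNIV \<phi>\<close>
        by (intro P.countably_subadditive_subadditive) (auto simp: outer_measure_space_def)
      then have "\<phi> (X \<union> (Y - X)) \<le> \<phi> X + \<phi> (Y - X)"
        unfolding subadditive_def by blast
      also have "\<dots> \<le> \<phi> X + \<phi> Y"
        by (intro add_left_mono \<phi>_mono) auto
      finally show ?thesis by simp
    qed
    show "\<phi> A \<le> \<phi> (A \<inter> U) + \<phi> (A - U)"
      using sub[of "A \<inter> U" "A - U"] by (simp add: Int_Diff_Un)
    \<comment> \<open>The two parts of \<open>A\<close> are measured by disjoint compact sets
      \<open>K\<close> and \<open>K'\<close> inside an open \<open>V\<close> containing
      \<open>A\<close>, where finite additivity of \<open>m\<close> applies. The choices of
      \<open>V\<close>, \<open>K\<close> and \<open>K'\<close> cost \<open>e / 3\<close>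
      each.\<close>
    show "\<phi> (A \<inter> U) + \<phi> (A - U) \<le> \<phi> A"
    proof (rule ennreal_le_epsilon)
      fix e :: real assume "0 < e"
      then have e: "0 < e / 3" by simp
      obtain V where V: "open V" "A \<subseteq> V" "l V \<le> \<phi> A + ennreal (e / 3)"
        using \<phi>_approx[OF e] by blast
      have VU: "open (V \<inter> U)"
        using V U by auto
      obtain K where K: "compact K" "K \<subseteq> V \<inter> U" "l (V \<inter> U) \<le> ennreal (m K) + ennreal (e / 3)"
        using l_approx[OF e VU] by blast
      \<comment> \<open>The set \<open>V - U\<close> need not be open. Its superset
        \<open>V - K\<close> is open, still contains \<open>A - U\<close>, and forces
        \<open>K'\<close> to be disjoint from \<open>K\<close>.\<close>
      have VK: "open (V - K)"
        using V K(1) by (auto intro!: open_Diff compact_imp_closed)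
      obtain K' where K': "compact K'" "K' \<subseteq> V - K" "l (V - K) \<le> ennreal (m K') + ennreal (e / 3)"
        using l_approx[OF e VK] by blast
      have "\<phi> (A \<inter> U) \<le> ennreal (m K) + ennreal (e / 3)"
        using V K \<phi>_mono[of "A \<inter> U" "V \<inter> U"] VU by (auto simp: \<phi>_open intro: order_trans)
      moreover have "\<phi> (A - U) \<le> ennreal (m K') + ennreal (e / 3)"
      proof -
        have "A - U \<subseteq> V - K" using V(2) K(2) by auto
        from \<phi>_mono[OF this] K'(3) VK show ?thesis
          by (auto simp: \<phi>_open intro: order_trans)
      qed
      ultimately have "\<phi> (A \<inter> U) + \<phi> (A - U)
          \<le> (ennreal (m K) + ennreal (e / 3)) + (ennreal (m K') + ennreal (e / 3))"
        by (rule add_mono)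
      also have "\<dots> = ennreal (m (K \<union> K')) + ennreal (2 * e / 3)"
        using K K' e by (subst add) (auto simp: nonneg simp flip: ennreal_plus)
      also have "\<dots> \<le> l V + ennreal (2 * e / 3)"
        using K K' by (intro add_right_mono l_upper) auto
      also have "\<dots> \<le> \<phi> A + ennreal (e / 3) + ennreal (2 * e / 3)"
        using V by (intro add_right_mono)
      also have "\<dots> = \<phi> A + ennreal e"
        using \<open>0 < e\<close> by (simp add: add.assoc flip: ennreal_plus)
      finally show "\<phi> (A \<inter> U) + \<phi> (A - U) \<le> \<phi> A + ennreal e" .
    qed
  qed
  moreover have "sigma_algebra UNIV ?L"
    using ms by (simp add: measure_space_def)
  ultimately have borel_sub: "sets borel \<subseteq> ?L"
    unfolding borel_def using sigma_algebra.sigma_sets_subset[of UNIV ?L "Collect open"]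
    by (simp add: subset_eq)

  \<comment> \<open>Restriction to the Borel sets and total mass\<close>
  define \<mu> where "\<mu> = measure_of UNIV (sets borel) \<phi>"
  have "measure_space UNIV (sets borel) \<phi>"
    unfolding measure_space_def
  proof (intro conjI)
    show "sigma_algebra UNIV (sets (borel :: 'a measure))"
      using sets.sigma_algebra_axioms[of "borel :: 'a measure"] by simp
    show "positive (sets borel) \<phi>"
      using ms by (simp add: measure_space_def positive_def)
    show "countably_additive (sets borel) \<phi>"
      unfolding countably_additive_def
    proof (intro allI impI)
      fix B :: "nat \<Rightarrow> 'a set" assume "range B \<subseteq> sets borel" "disjoint_family B" "(\<Union>i. B i) \<in> sets borel"
      with borel_sub have "range B \<subseteq> ?L" "(\<Union>i. B i) \<in> ?L" by auto
      with ms \<open>disjoint_family B\<close> show "(\<Sum>i. \<phi> (B i)) = \<phi> (\<Union>i. B i)"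
        unfolding measure_space_def countably_additive_def by simp
    qed
  qed
  then have em: "emeasure \<mu> A = \<phi> A" if "A \<in> sets borel" for A
    using that unfolding \<mu>_def measure_space_def by (elim conjE) (rule emeasure_measure_of_sigma)
  have sets: "sets \<mu> = sets borel"
    unfolding \<mu>_def using sets.sigma_sets_eq[of "borel :: 'a measure"] by simp
  show thesis
  proof (rule that[OF sets])
    show "emeasure \<mu> U \<le> ennreal (m U)" if "open U" for U
      using that by (simp add: em \<phi>_open l_le)
    \<comment> \<open>Tightness supplies a compact set of \<open>m\<close>-mass at least
      \<open>1 - e\<close>, and \<open>l\<close> takes compact sets into account.\<close>
    have "1 \<le> l UNIV"
    proof (rule ennreal_le_epsilon)
      fix e :: real assume "0 < e"
      then obtain K where K: "compact K" "m (- K) \<le> e"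
        using tight by blast
      have "1 = m K + m (- K)"
        using add[of K "- K"] total K borel_comp[of K] by simp
      also have "\<dots> \<le> m K + e" using K by simp
      finally have "ennreal 1 \<le> ennreal (m K) + ennreal e"
        using \<open>0 < e\<close> nonneg[of K] K by (simp flip: ennreal_plus)
      also have "\<dots> \<le> l UNIV + ennreal e"
        using K by (intro add_right_mono l_upper) auto
      finally show "1 \<le> l UNIV + ennreal e" by simp
    qed
    moreover have "l UNIV \<le> 1"
      using l_le[of UNIV] total by simp
    ultimately show "prob_space \<mu>"
      using sets_eq_imp_space_eq[OF sets] by (intro prob_spaceI) (simp add: em \<phi>_open)
  qed
qed

section \<open>Tightness and weak convergence\<close>

text \<open>The sum counts the integers from 1 to \<open>N\<close> strictly below \<open>t\<close>.
  The count stops growing at \<open>N\<close> when \<open>t\<close> is large, hence the disjunction;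
  all three parts are carried together because the induction step uses the bound by
  \<open>N\<close>.\<close>

lemma sum_indicator_less:
  fixes t :: real
  assumes "0 \<le> t"
  shows "(\<Sum>j=1..N. indicator {real j<..} t) \<le> t \<and>
    (\<Sum>j=1..N. indicator {real j<..} t) \<le> real N \<and>
    (t - 1 \<le> (\<Sum>j=1..N. indicator {real j<..} t) \<or> real N \<le> (\<Sum>j=1..N. indicator {real j<..} t))"
proof (induction N)
  case (Suc N)
  then show ?case
    by (cases "real (Suc N) < t") auto
qed (use assms in simp)

text \<open>A discrete layer-cake formula: the step function \<open>h\<close> counts the levels
  \<open>j / N\<close> strictly below \<open>f\<close> and lies below \<open>f\<close> by at most
  \<open>1 / N\<close>. The strict inequality makes the superlevel sets open when \<open>f\<close>
  is continuous, so bounds on open sets carry over to integrals.\<close>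

lemma (in prob_space) integral_layer_sum:
  fixes f :: "'a \<Rightarrow> real"
  assumes [measurable]: "f \<in> borel_measurable M" and f: "\<And>x. 0 \<le> f x" "\<And>x. f x \<le> 1" and "1 \<le> N"
  defines "s \<equiv> (\<Sum>j=1..N. measure M {x\<in>space M. real j < real N * f x}) / real N"
  shows "s \<le> (\<integral>x. f x \<partial>M)" "(\<integral>x. f x \<partial>M) \<le> s + 1 / real N"
proof -
  define h where "h x = (\<Sum>j=1..N. indicator {real j<..} (real N * f x)) / real N" for x
  have N: "0 < real N" using \<open>1 \<le> N\<close> by simp
  have "h x \<le> f x \<and> f x \<le> h x + 1 / real N" for x
  proof -
    have "real N * f x \<le> real N"
      using f(2)[of x] N by simp
    with sum_indicator_less[of "real N * f x" N] f(1)[of x] N show ?thesis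
      by (auto simp: h_def field_simps)
  qed
  note h = this
  have int_ind: "integrable M (\<lambda>x. indicator {real j<..} (real N * f x) :: real)" for j
    by (intro integrable_const_bound[where B=1]) auto
  have [simp]: "integrable M h"
    unfolding h_def by (intro integrable_divide_zero Bochner_Integration.integrable_sum int_ind)
  have [simp]: "integrable M f"
    using f by (intro integrable_const_bound[where B=1]) auto
  have "(\<integral>x. indicator {real j<..} (real N * f x) \<partial>M) = measure M {x\<in>space M. real j < real N * f x}" for j
  proof -
    have "(\<integral>x. indicator {real j<..} (real N * f x) \<partial>M)
        = (\<integral>x. indicat_real {x\<in>space M. real j < real N * f x} x \<partial>M)"
      by (intro Bochner_Integration.integral_cong) (auto simp: indicator_def)
    also have "\<dots> = measure M {x\<in>space M. real j < real N * f x}"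
      by (subst Bochner_Integration.integral_indicator) (auto simp: Int_def conj_commute)
    finally show ?thesis .
  qed
  then have s: "s = (\<integral>x. h x \<partial>M)"
    unfolding s_def h_def by (simp add: Bochner_Integration.integral_sum[OF int_ind])
  show "s \<le> (\<integral>x. f x \<partial>M)"
    unfolding s using h by (intro integral_mono) auto
  have "(\<integral>x. f x \<partial>M) \<le> (\<integral>x. h x + 1 / real N \<partial>M)"
    using h by (intro integral_mono) auto
  then show "(\<integral>x. f x \<partial>M) \<le> s + 1 / real N"
    unfolding s by (simp add: prob_space)
qed

text \<open>A form of Prokhorov's theorem. Compactness provides limits \<open>L f\<close> of all the
  integrals at once. Layer sums and the bound of \<mu> by \<open>m\<close> on open sets show that
  the \<mu>-integral is at most \<open>L f\<close> when \<open>f\<close> is continuous with values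
  between 0 and 1; an affine rescaling extends this to bounded continuous \<open>f\<close>, and the
  case of \<open>- f\<close> turns it into equality.\<close>

lemma tight_imp_weakly_convergent_subfilter:
  fixes M :: "'i \<Rightarrow> 'a::metric_space measure"
  assumes F: "F \<noteq> bot"
    and prob: "\<forall>\<^sub>F i in F. prob_space (M i) \<and> sets (M i) = sets borel"
    and tight: "\<And>e. 0 < e \<Longrightarrow> \<exists>K. compact K \<and> (\<forall>\<^sub>F i in F. measure (M i) (- K) \<le> e)"
  obtains G \<mu> where "G \<le> F" "G \<noteq> bot" "sets \<mu> = sets borel" "prob_space \<mu>"
    "\<And>f::'a \<Rightarrow> real. continuous_on UNIV f \<Longrightarrow> bounded (range f) \<Longrightarrow>
      ((\<lambda>i. \<integral>x. f x \<partial>M i) \<longlongrightarrow> (\<integral>x. f x \<partial>\<mu>)) G"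
proof -

  \<comment> \<open>Compactness of the space of integrals\<close>
  define B where "B = {f::'a \<Rightarrow> real. f \<in> borel_measurable borel \<and> bounded (range f)}"
  \<comment> \<open>The default 0 outside \<open>B\<close> makes \<open>X i\<close> a point of the
    product over all functions; it respects the radii \<open>c f\<close> because these are
    nonnegative for every \<open>f\<close>.\<close>
  define X where "X i f = (if f \<in> B then \<integral>x. f x \<partial>M i else 0)" for i f
  have "\<exists>c\<ge>0. f \<in> B \<longrightarrow> (\<forall>x. \<bar>f x\<bar> \<le> c)" for f
    unfolding B_def bounded_iff by (auto intro: order_trans[OF abs_ge_zero])
  then obtain c where c: "\<And>f. 0 \<le> c f" "\<And>f x. f \<in> B \<Longrightarrow> \<bar>f x\<bar> \<le> c f"
    by metis
  define S where "S = (\<Pi>\<^sub>E f\<in>UNIV. cball (0::real) (c f))"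
  have "compactin (product_topology (\<lambda>i. euclidean) UNIV) S"
    unfolding S_def compactin_PiE by simp
  then have "compact S"
    by (simp add: euclidean_product_topology)
  have X_mem: "X i \<in> S" if "prob_space (M i) \<and> sets (M i) = sets borel" for i
  proof -
    interpret prob_space "M i" using that by simp
    have "\<bar>\<integral>x. f x \<partial>M i\<bar> \<le> c f" if "f \<in> B" for f
    proof -
      have "integrable (M i) f"
        using that \<open>prob_space (M i) \<and> _\<close> c(2)[OF that]
        by (intro integrable_const_bound[where B="c f"]) (auto simp: B_def cong: measurable_cong_sets)
      then have "\<bar>\<integral>x. f x \<partial>M i\<bar> \<le> (\<integral>x. c f \<partial>M i)"
        using c(2)[OF that] integral_norm_bound[of "M i" f]
        by (intro order_trans[OF integral_abs_bound] integral_mono) auto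
      then show ?thesis by (simp add: prob_space)
    qed
    then show ?thesis
      by (auto simp: S_def X_def c PiE_iff)
  qed
  have "\<forall>\<^sub>F y in filtermap X F. y \<in> S"
    using prob X_mem by (auto simp: eventually_filtermap elim: eventually_mono)
  moreover have "filtermap X F \<noteq> bot"
    using F by (simp add: filtermap_bot_iff)
  ultimately obtain L where L: "inf (nhds L) (filtermap X F) \<noteq> bot"
    using \<open>compact S\<close> unfolding compact_filter by blast
  \<comment> \<open>The neighbourhoods of the cluster point \<open>L\<close>, pulled back to the
    indices and combined with \<open>F\<close>, play the part of a convergent subnet.\<close>
  define G where "G = inf (filtercomap X (nhds L)) F"
  have GF: "G \<le> F" by (simp add: G_def)
  have G: "G \<noteq> bot"
  \<comment> \<open>A trivial \<open>G\<close> would separate a neighbourhood of \<open>L\<close>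
    from the image filter, and \<open>L\<close> would not be a cluster point.\<close>
  proof
    assume "G = bot"
    then have "\<forall>\<^sub>F x in G. False" by simp
    then obtain P Q where "\<forall>\<^sub>F x in filtercomap X (nhds L). P x" and Q: "\<forall>\<^sub>F x in F. Q x" "\<And>x. \<not> (P x \<and> Q x)"
      unfolding G_def eventually_inf by auto
    then obtain R where R: "\<forall>\<^sub>F y in nhds L. R y" "\<And>x. R (X x) \<Longrightarrow> P x"
      unfolding eventually_filtercomap by auto
    have "\<forall>\<^sub>F y in filtermap X F. \<not> R y"
      unfolding eventually_filtermap using Q R by (auto elim: eventually_mono)
    with R(1) have "\<forall>\<^sub>F y in inf (nhds L) (filtermap X F). False"
      unfolding eventually_inf by blast
    with L show False by (simp add: trivial_limit_def)
  qed
  have "(X \<longlongrightarrow> L) G"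
    unfolding G_def filterlim_iff_le_filtercomap by simp
  have coord: "((\<lambda>i. X i f) \<longlongrightarrow> L f) G" for f
  proof -
    have "continuous_on UNIV (\<lambda>y::('a \<Rightarrow> real) \<Rightarrow> real. y f)"
      by (rule continuous_on_product_coordinates)
    then show ?thesis
      using \<open>(X \<longlongrightarrow> L) G\<close> by (rule continuous_on_tendsto_compose) auto
  qed
  have lim: "((\<lambda>i. \<integral>x. f x \<partial>M i) \<longlongrightarrow> L f) G" if "f \<in> borel_measurable borel" "bounded (range f)" for f
    using coord[of f] that by (simp add: X_def B_def)
  have good: "\<forall>\<^sub>F i in G. prob_space (M i) \<and> sets (M i) = sets borel"
    using prob GF by (simp add: le_filter_def)

  \<comment> \<open>The limiting set function and the measure obtained from it\<close>
  define m where "m A = L (indicator A)" for A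
  have bdd_ind: "bounded (range (indicator A :: 'a \<Rightarrow> real))" for A
    by (rule bounded_subset[of "{0,1}"]) (auto simp: indicator_def)
  have m_lim: "((\<lambda>i. measure (M i) A) \<longlongrightarrow> m A) G" if [measurable]: "A \<in> sets borel" for A
  proof (rule Lim_transform_eventually)
    show "((\<lambda>i. \<integral>x. indicator A x \<partial>M i) \<longlongrightarrow> m A) G"
      unfolding m_def by (rule lim) (auto simp: bdd_ind)
    show "\<forall>\<^sub>F i in G. (\<integral>x. indicator A x \<partial>M i) = measure (M i) A"
      using good by eventually_elim (use that in \<open>auto dest: sets_eq_imp_space_eq\<close>)
  qed
  \<comment> \<open>Nonnegativity, finite additivity, total mass and the tightness bounds pass to
    limits of numbers. Countable additivity need not, which is why the measure has to be constructed
    from \<open>m\<close>.\<close>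
  obtain \<mu> where \<mu>: "sets \<mu> = sets borel" "prob_space \<mu>" "\<And>U. open U \<Longrightarrow> emeasure \<mu> U \<le> ennreal (m U)"
  proof (rule finitely_additive_tight_imp_measure[of m])
    show "0 \<le> m A" if "A \<in> sets borel" for A
      by (rule tendsto_lowerbound[OF m_lim[OF that]]) (auto simp: G)
    show "m (A \<union> C) = m A + m C" if [measurable]: "A \<in> sets borel" "C \<in> sets borel" and "A \<inter> C = {}" for A C
    proof (rule tendsto_unique[OF G m_lim])
      have "((\<lambda>i. measure (M i) A + measure (M i) C) \<longlongrightarrow> m A + m C) G"
        by (intro tendsto_add m_lim) auto
      moreover have "\<forall>\<^sub>F i in G. measure (M i) A + measure (M i) C = measure (M i) (A \<union> C)"
        using good
      proof eventually_elim
        case (elim i)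
        then interpret prob_space "M i" by simp
        show ?case using elim that by (intro finite_measure_Union[symmetric]) auto
      qed
      ultimately show "((\<lambda>i. measure (M i) (A \<union> C)) \<longlongrightarrow> m A + m C) G"
        by (rule Lim_transform_eventually)
    qed simp
    show "m UNIV = 1"
    proof (rule tendsto_unique[OF G m_lim])
      have "\<forall>\<^sub>F i in G. 1 = measure (M i) UNIV"
        using good by eventually_elim (metis prob_space.prob_space sets_eq_imp_space_eq space_borel)
      then show "((\<lambda>i. measure (M i) UNIV) \<longlongrightarrow> 1) G"
        by (rule Lim_transform_eventually[OF tendsto_const])
    qed simp
    show "\<exists>K. compact K \<and> m (- K) \<le> e" if e: "0 < e" for e
    proof -
      obtain K where K: "compact K" "\<forall>\<^sub>F i in F. measure (M i) (- K) \<le> e"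
        using tight[OF e] by blast
      have "m (- K) \<le> e"
        using K GF by (intro tendsto_upperbound[OF m_lim _ G] borel_comp borel_closed compact_imp_closed)
          (auto simp: le_filter_def)
      with K show ?thesis by blast
    qed
  qed blast
  interpret \<mu>: prob_space \<mu> by fact
  have space_\<mu>: "space \<mu> = UNIV"
    using sets_eq_imp_space_eq[OF \<mu>(1)] by simp

  \<comment> \<open>Comparison of the limits \<open>L f\<close> with integrals against \<mu>\<close>
  have unit: "(\<integral>x. f x \<partial>\<mu>) \<le> L f"
    if f: "continuous_on UNIV f" "\<And>x. 0 \<le> f x" "\<And>x. f x \<le> 1" for f
  proof (rule field_le_epsilon)
    fix e :: real assume "0 < e"
    then obtain N where N: "1 / real (Suc N) < e"
      using nat_approx_posE by metis
    let ?N = "Suc N"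
    have [measurable]: "f \<in> borel_measurable borel"
      using f(1) by (rule borel_measurable_continuous_onI)
    define U where "U j = {x. real j < real ?N * f x}" for j
    have U: "open (U j)" for j
      unfolding U_def by (intro open_Collect_less continuous_intros f)
    have "bounded (range f)"
      unfolding bounded_iff using f by (intro exI[of _ 1]) auto
    \<comment> \<open>The lower layer bound holds for each \<open>M i\<close> and involves finitely
      many open sets, so it survives the limit with \<open>m\<close> in place of the measures. Below
      it meets the upper layer bound for \<mu>, at the cost of \<open>1 / Suc N\<close>, which is
      less than \<open>e\<close>.\<close>
    have low: "(\<Sum>j=1..?N. m (U j)) / real ?N \<le> L f"
    proof (rule tendsto_le[OF G])
      show "((\<lambda>i. \<integral>x. f x \<partial>M i) \<longlongrightarrow> L f) G"
        by (rule lim) fact+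
      show "((\<lambda>i. (\<Sum>j=1..?N. measure (M i) (U j)) / real ?N) \<longlongrightarrow> (\<Sum>j=1..?N. m (U j)) / real ?N) G"
        using U by (intro tendsto_intros m_lim) auto
      show "\<forall>\<^sub>F i in G. (\<Sum>j=1..?N. measure (M i) (U j)) / real ?N \<le> (\<integral>x. f x \<partial>M i)"
        using good
      proof eventually_elim
        case (elim i)
        then interpret prob_space "M i" by simp
        have "f \<in> borel_measurable (M i)" "space (M i) = UNIV"
          using elim sets_eq_imp_space_eq[of "M i" borel] by (auto cong: measurable_cong_sets)
        with integral_layer_sum(1)[of f ?N] f(2,3) show ?case
          by (simp add: U_def)
      qed
    qed
    have "(\<integral>x. f x \<partial>\<mu>) \<le> (\<Sum>j=1..?N. measure \<mu> (U j)) / real ?N + 1 / real ?N"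
      using \<mu>.integral_layer_sum(2)[of f ?N] f \<mu>(1) space_\<mu>
      by (simp add: U_def cong: measurable_cong_sets)
    also have "\<dots> \<le> (\<Sum>j=1..?N. m (U j)) / real ?N + 1 / real ?N"
    proof (intro add_right_mono divide_right_mono sum_mono)
      fix j
      have "0 \<le> m (U j)"
        by (rule tendsto_lowerbound[OF m_lim]) (auto simp: G U)
      with \<mu>(3)[OF U, of j] show "measure \<mu> (U j) \<le> m (U j)"
        by (simp add: \<mu>.emeasure_eq_measure)
    qed simp
    also have "\<dots> \<le> L f + e"
      using low N by simp
    finally show "(\<integral>x. f x \<partial>\<mu>) \<le> L f + e" .
  qed
  have le: "(\<integral>x. f x \<partial>\<mu>) \<le> L f" if f: "continuous_on UNIV f" "bounded (range f)" for f
  proof -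
    obtain a where a: "\<And>x. \<bar>f x\<bar> \<le> a"
      using f(2) unfolding bounded_iff by auto
    \<comment> \<open>The maximum with 1 keeps the divisor \<open>2 * d\<close> positive even if
      \<open>f\<close> vanishes.\<close>
    define d where "d = max a 1"
    have d: "0 < d" "\<And>x. \<bar>f x\<bar> \<le> d"
      using a by (auto simp: d_def le_max_iff_disj)
    let ?h = "\<lambda>x. (f x + d) / (2 * d)"
    have [measurable]: "f \<in> borel_measurable borel"
      using f(1) by (rule borel_measurable_continuous_onI)
    have int: "(\<integral>x. ?h x \<partial>N) = ((\<integral>x. f x \<partial>N) + d) / (2 * d)"
      if "prob_space N" "sets N = sets borel" for N
    proof -
      interpret prob_space N by fact
      have "integrable N f"
        using d(2) that by (intro integrable_const_bound[where B=d]) (auto cong: measurable_cong_sets)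
      then show ?thesis by (simp add: prob_space)
    qed
    have h: "continuous_on UNIV ?h" "\<And>x. 0 \<le> ?h x" "\<And>x. ?h x \<le> 1"
    proof -
      show "continuous_on UNIV ?h"
        using d f by (intro continuous_intros) auto
      show "0 \<le> ?h x" "?h x \<le> 1" for x
        using d(1) d(2)[of x] by (auto simp: field_simps)
    qed
    \<comment> \<open>Linearity of \<open>L\<close> is not built into it; the affine relation comes
      from uniqueness of limits along the proper filter \<open>G\<close>.\<close>
    have "L ?h = (L f + d) / (2 * d)"
    proof (rule tendsto_unique[OF G])
      show "((\<lambda>i. \<integral>x. ?h x \<partial>M i) \<longlongrightarrow> L ?h) G"
      proof (rule lim)
        show "?h \<in> borel_measurable borel"
          by (rule borel_measurable_continuous_onI) (rule h(1))
        show "bounded (range ?h)"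
          by (rule bounded_subset[of "{0..1}"]) (use h(2,3) in \<open>auto simp del: zero_le_divide_iff\<close>)
      qed
      have "((\<lambda>i. ((\<integral>x. f x \<partial>M i) + d) / (2 * d)) \<longlongrightarrow> (L f + d) / (2 * d)) G"
        using d f by (intro tendsto_intros lim) auto
      moreover have "\<forall>\<^sub>F i in G. ((\<integral>x. f x \<partial>M i) + d) / (2 * d) = (\<integral>x. ?h x \<partial>M i)"
        using good by eventually_elim (rule int[symmetric]; simp)
      ultimately show "((\<lambda>i. \<integral>x. ?h x \<partial>M i) \<longlongrightarrow> (L f + d) / (2 * d)) G"
        by (rule Lim_transform_eventually)
    qed
    with unit[OF h] int[OF \<mu>(2,1)] d(1) show ?thesis
      by (simp add: divide_le_cancel)
  qed
  show thesis
  proof (rule that[OF GF G \<mu>(1,2)])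
    fix f :: "'a \<Rightarrow> real" assume f: "continuous_on UNIV f" "bounded (range f)"
    then have meas: "f \<in> borel_measurable borel"
      by (simp add: borel_measurable_continuous_onI)
    have mf: "continuous_on UNIV (\<lambda>x. - f x)" "bounded (range (\<lambda>x. - f x))"
      using f by (auto intro: continuous_intros simp: bounded_iff)
    have "L (\<lambda>x. - f x) = - L f"
    proof (rule tendsto_unique[OF G])
      show "((\<lambda>i. \<integral>x. - f x \<partial>M i) \<longlongrightarrow> L (\<lambda>x. - f x)) G"
        using mf meas by (intro lim) auto
      show "((\<lambda>i. \<integral>x. - f x \<partial>M i) \<longlongrightarrow> - L f) G"
        using lim[OF meas f(2)] by (simp add: tendsto_minus)
    qed
    with le[OF f] le[OF mf] have "L f = (\<integral>x. f x \<partial>\<mu>)" by simp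
    with lim[OF meas f(2)] show "((\<lambda>i. \<integral>x. f x \<partial>M i) \<longlongrightarrow> (\<integral>x. f x \<partial>\<mu>)) G"
      by simp
  qed
qed

text \<open>The indicator of a nonempty closed set is the pointwise limit of truncated linear
  functions of the distance to it, so dominated convergence gives equality on closed sets, an
  intersection-stable generator of the Borel sets.\<close>

lemma prob_measure_eqI_continuous:
  fixes M N :: "'a::metric_space measure"
  assumes "prob_space M" "sets M = sets borel" and "prob_space N" "sets N = sets borel"
    and eq: "\<And>f::'a \<Rightarrow> real. continuous_on UNIV f \<Longrightarrow> (\<And>x. 0 \<le> f x) \<Longrightarrow> (\<And>x. f x \<le> 1) \<Longrightarrow>
      (\<integral>x. f x \<partial>M) = (\<integral>x. f x \<partial>N)"
  shows "M = N"
proof -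
  interpret M: prob_space M by fact
  interpret N: prob_space N by fact
  have "emeasure M C = emeasure N C" if "closed C" for C
  \<comment> \<open>The distance to the empty set is 0 by convention, so the functions below would
    be constantly 1 there instead of tending to the indicator.\<close>
  proof (cases "C = {}")
    case False
    define f where "f k x = max 0 (1 - real k * infdist x C)" for k :: nat and x
    have f: "continuous_on UNIV (f k)" "0 \<le> f k x" "f k x \<le> 1" for k x
      unfolding f_def by (auto intro!: continuous_intros simp: infdist_nonneg)
    have [measurable]: "f k \<in> borel_measurable borel" for k
      by (rule borel_measurable_continuous_onI) (rule f)
    have pointwise: "(\<lambda>k. f k x) \<longlonglongrightarrow> indicator C x" for x
    proof (cases "x \<in> C")
      case True
      then show ?thesis by (simp add: f_def)
    next
      case x: False
      then have pos: "0 < infdist x C"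
        using infdist_pos_not_in_closed[OF \<open>closed C\<close> False] by simp
      obtain n where n: "1 < real n * infdist x C"
        using ex_less_of_nat_mult[OF pos] by blast
      have "\<forall>\<^sub>F k in sequentially. 0 = f k x"
        using eventually_ge_at_top[of n]
      proof eventually_elim
        case (elim k)
        then have "real n * infdist x C \<le> real k * infdist x C"
          using pos by (intro mult_right_mono) auto
        with n show ?case by (simp add: f_def)
      qed
      with x show ?thesis
        by (auto intro: Lim_transform_eventually[OF tendsto_const])
    qed
    have "(\<lambda>k. \<integral>x. f k x \<partial>Q) \<longlonglongrightarrow> measure Q C" if "prob_space Q" and Q: "sets Q = sets borel" for Q
    proof -
      interpret prob_space Q by fact
      have "C \<in> sets Q" using Q \<open>closed C\<close> by auto
      have "(\<lambda>k. \<integral>x. f k x \<partial>Q) \<longlonglongrightarrow> (\<integral>x. indicator C x \<partial>Q)"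
      proof (rule integral_dominated_convergence[where w="\<lambda>_. 1"])
        show "indicat_real C \<in> borel_measurable Q" using \<open>C \<in> sets Q\<close> by simp
        show "f k \<in> borel_measurable Q" for k using Q by (simp cong: measurable_cong_sets)
      qed (use pointwise f in auto)
      with \<open>C \<in> sets Q\<close> show ?thesis
        by (simp add: sets.sets_into_space Int_absorb2)
    qed
    from this[OF assms(1,2)] this[OF assms(3,4)] have "measure M C = measure N C"
      using eq[OF f] by (simp add: LIMSEQ_unique)
    then show ?thesis
      by (simp add: M.emeasure_eq_measure N.emeasure_eq_measure)
  qed simp
  then show ?thesis
    using assms(2,4)
    by (intro measure_eqI_generator_eq[where E="Collect closed" and \<Omega>=UNIV and A="\<lambda>_. UNIV"])
      (auto simp: Int_stable_def borel_eq_closed)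
qed

section \<open>Augmented kernels\<close>

text \<open>The restriction of \<open>P\<close> to \<open>A\<close> and \<open>Q\<close> share their
  measurable sets, so setwise domination is the order on measures and monotonicity of the integral
  in the measure applies.\<close>

lemma nn_integral_augmentation_mono:
  assumes P: "sets P = sets borel" and A: "A \<in> sets borel"
    and Q: "sets Q = sets (restrict_space borel A)"
    and le: "\<And>B. B \<in> sets (restrict_space borel A) \<Longrightarrow> emeasure P B \<le> emeasure Q B"
  shows "(\<integral>\<^sup>+y. h y * indicator A y \<partial>P) \<le> (\<integral>\<^sup>+y. h y \<partial>Q)"
proof -
  have S: "sets (restrict_space P A) = sets Q"
    using P Q by (simp add: sets_restrict_space)
  have "emeasure (restrict_space P A) \<le> emeasure Q"
  proof (rule le_funI)
    fix B
    show "emeasure (restrict_space P A) B \<le> emeasure Q B"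
    proof (cases "B \<in> sets Q")
      case True
      then have "B \<subseteq> A" and "emeasure P B \<le> emeasure Q B"
        using Q le[of B] by (auto simp: sets_restrict_space)
      with P A show ?thesis
        by (simp add: emeasure_restrict_space sets_eq_imp_space_eq[OF P])
    next
      \<comment> \<open>The order compares \<open>emeasure\<close> on all sets; on a nonmeasurable
        one both values are 0.\<close>
      case False
      with S show ?thesis by (simp add: emeasure_notin_sets)
    qed
  qed
  then have "restrict_space P A \<le> Q"
    using S sets_eq_imp_space_eq[OF S] by (simp add: le_measure_iff)
  then have "(\<integral>\<^sup>+y. h y \<partial>restrict_space P A) \<le> (\<integral>\<^sup>+y. h y \<partial>Q)"
    using S by (rule nn_integral_mono_measure[rotated])
  then show ?thesis
    using P A by (subst (asm) nn_integral_restrict_space) auto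
qed

text \<open>The mass that \<open>Q\<close> has in excess of \<open>P\<close> on \<open>A\<close> was moved there from outside \<open>A\<close>,
  where \<open>g\<close> is larger.\<close>

lemma nn_integral_augmentation_sublevel_le:
  fixes g :: "'a::topological_space \<Rightarrow> real"
  assumes "prob_space P" and P: "sets P = sets borel" and "prob_space Q"
    and g[measurable]: "g \<in> borel_measurable borel" "\<And>x. 0 \<le> g x" and c: "0 \<le> c"
    and A: "A = {x. g x \<le> c}"
    and Q: "sets Q = sets (restrict_space borel A)"
    and le: "\<And>B. B \<in> sets (restrict_space borel A) \<Longrightarrow> emeasure P B \<le> emeasure Q B"
  shows "(\<integral>\<^sup>+y. ennreal (g y) \<partial>Q) \<le> (\<integral>\<^sup>+y. ennreal (g y) \<partial>P)"
proof -
  interpret P: prob_space P by fact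
  interpret Q: prob_space Q by fact
  have A_meas[measurable]: "A \<in> sets borel" unfolding A by measurable
  have space: "space P = UNIV" "space Q = A"
    using sets_eq_imp_space_eq[OF P] sets_eq_imp_space_eq[OF Q] by (auto simp: space_restrict_space)
  have measQ: "f \<in> borel_measurable Q" if "f \<in> borel_measurable borel" for f :: "'a \<Rightarrow> ennreal"
    unfolding measurable_cong_sets[OF Q refl] using that by (rule measurable_restrict_space1)
  have measP: "f \<in> borel_measurable P" if "f \<in> borel_measurable borel" for f :: "'a \<Rightarrow> ennreal"
    unfolding measurable_cong_sets[OF P refl] using that .
  \<comment> \<open>Domination of \<open>P\<close> by \<open>Q\<close> on \<open>A\<close> bounds
    \<open>g\<close> in the wrong direction, so it is applied to \<open>c - g\<close>, which is
    nonnegative on \<open>A\<close>. Equality of the total masses then reverses the inequality, and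
    outside \<open>A\<close> the constant \<open>c\<close> lies below \<open>g\<close>.\<close>
  let ?d = "\<integral>\<^sup>+y. ennreal (c - g y) * indicator A y \<partial>P"
  have split: "ennreal (g y) + ennreal (c - g y) = ennreal c" if "y \<in> A" for y
    using that g(2) by (simp add: A flip: ennreal_plus)
  have "(\<integral>\<^sup>+y. ennreal (g y) \<partial>Q) + ?d \<le> (\<integral>\<^sup>+y. ennreal (g y) \<partial>Q) + (\<integral>\<^sup>+y. ennreal (c - g y) \<partial>Q)"
    using nn_integral_augmentation_mono[OF P A_meas Q le] by (intro add_left_mono) auto
  also have "\<dots> = (\<integral>\<^sup>+y. ennreal (g y) + ennreal (c - g y) \<partial>Q)"
    by (rule nn_integral_add[symmetric]; rule measQ; measurable)
  also have "\<dots> = (\<integral>\<^sup>+y. ennreal c \<partial>Q)"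
    by (rule nn_integral_cong) (simp add: split space)
  also have "\<dots> = (\<integral>\<^sup>+y. ennreal c \<partial>P)"
    by (simp add: P.emeasure_space_1 Q.emeasure_space_1)
  also have "\<dots> \<le> (\<integral>\<^sup>+y. ennreal (g y) + ennreal (c - g y) * indicator A y \<partial>P)"
  proof (rule nn_integral_mono)
    fix y
    show "ennreal c \<le> ennreal (g y) + ennreal (c - g y) * indicator A y"
      by (cases "y \<in> A") (auto simp: split A intro!: ennreal_leI)
  qed
  also have "\<dots> = (\<integral>\<^sup>+y. ennreal (g y) \<partial>P) + ?d"
    by (rule nn_integral_add; rule measP; measurable)
  finally have "(\<integral>\<^sup>+y. ennreal (g y) \<partial>Q) + ?d \<le> (\<integral>\<^sup>+y. ennreal (g y) \<partial>P) + ?d" .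
  \<comment> \<open>Finiteness permits cancelling \<open>?d\<close> on both sides.\<close>
  moreover have "?d < \<top>"
  proof -
    have "?d \<le> (\<integral>\<^sup>+y. ennreal c \<partial>P)"
      using g(2) by (intro nn_integral_mono) (auto simp: indicator_def intro!: ennreal_leI)
    also have "\<dots> < \<top>" by (simp add: P.emeasure_space_1)
    finally show ?thesis .
  qed
  ultimately show ?thesis
    by (auto simp: add.commute[of _ ?d])
qed

text \<open>On \<open>A\<close> the two measures compare directly; outside, \<open>f \<le> 1\<close>
  costs at most the mass that escapes.\<close>

lemma nn_integral_le_augmentation:
  assumes P: "sets P = sets borel" and A: "A \<in> sets borel"
    and Q: "sets Q = sets (restrict_space borel A)"
    and le: "\<And>B. B \<in> sets (restrict_space borel A) \<Longrightarrow> emeasure P B \<le> emeasure Q B"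
    and f: "f \<in> borel_measurable borel" "\<And>x. f x \<le> 1"
  shows "(\<integral>\<^sup>+y. f y \<partial>P) \<le> (\<integral>\<^sup>+y. f y \<partial>Q) + emeasure P (- A)"
proof -
  have [measurable]: "f \<in> borel_measurable P" "A \<in> sets P" "- A \<in> sets P"
    using f(1) P A by (auto cong: measurable_cong_sets)
  have "(\<integral>\<^sup>+y. f y \<partial>P) \<le> (\<integral>\<^sup>+y. f y * indicator A y + indicator (- A) y \<partial>P)"
    using f(2) by (intro nn_integral_mono) (auto simp: indicator_def)
  also have "\<dots> = (\<integral>\<^sup>+y. f y * indicator A y \<partial>P) + (\<integral>\<^sup>+y. indicator (- A) y \<partial>P)"
    by (rule nn_integral_add) measurable
  also have "\<dots> \<le> (\<integral>\<^sup>+y. f y \<partial>Q) + emeasure P (- A)"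
    using nn_integral_augmentation_mono[OF P A Q le] by (intro add_mono) auto
  finally show ?thesis .
qed

text \<open>Stationarity on sets says that \<mu> equals \<open>\<mu> \<bind> K\<close>, and
  integrals against a bind are iterated integrals.\<close>

lemma nn_integral_stationary:
  assumes K: "stochastic_kernel M K" and \<mu>: "\<mu> \<in> stationary_distributions M K"
    and h: "h \<in> borel_measurable M"
  shows "(\<integral>\<^sup>+x. h x \<partial>\<mu>) = (\<integral>\<^sup>+x. \<integral>\<^sup>+y. h y \<partial>K x \<partial>\<mu>)"
proof -
  have \<mu>s: "sets \<mu> = sets M" and "prob_space \<mu>"
    and inv: "\<And>B. B \<in> sets M \<Longrightarrow> emeasure \<mu> B = (\<integral>\<^sup>+x. emeasure (K x) B \<partial>\<mu>)"
    using \<mu> by (auto simp: stationary_distributions_def space_prob_algebra)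
  have K': "K \<in> measurable \<mu> (subprob_algebra M)"
    using K measurable_prob_algebraD \<mu>s
    by (auto simp: stochastic_kernel_def cong: measurable_cong_sets)
  have ne: "space \<mu> \<noteq> {}"
    using \<open>prob_space \<mu>\<close> by (rule prob_space.not_empty)
  have "\<mu> = \<mu> \<bind> K"
    using \<mu>s inv ne by (intro measure_eqI) (auto simp: sets_bind[OF sets_kernel[OF K']] emeasure_bind[OF ne K'])
  then have "(\<integral>\<^sup>+x. h x \<partial>\<mu>) = (\<integral>\<^sup>+x. h x \<partial>(\<mu> \<bind> K))" by simp
  also have "\<dots> = (\<integral>\<^sup>+x. \<integral>\<^sup>+y. h y \<partial>K x \<partial>\<mu>)"
    using h K' by (rule nn_integral_bind)
  finally show ?thesis .
qed

lemma extend_measure_zero_prob: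
  assumes "\<mu> \<in> space (prob_algebra (restrict_space borel A))"
  shows "prob_space (extend_measure_zero \<mu>)" "sets (extend_measure_zero \<mu>) = sets borel"
    and "\<And>h. h \<in> borel_measurable borel \<Longrightarrow> (\<integral>\<^sup>+x. h x \<partial>extend_measure_zero \<mu>) = (\<integral>\<^sup>+x. h x \<partial>\<mu>)"
proof -
  have "prob_space \<mu>" and \<mu>: "sets \<mu> = sets (restrict_space borel A)"
    using assms by (auto simp: space_prob_algebra)
  have id: "(\<lambda>x. x) \<in> measurable \<mu> borel"
    unfolding measurable_cong_sets[OF \<mu> refl] by (rule measurable_restrict_space1) simp
  show "prob_space (extend_measure_zero \<mu>)"
    unfolding extend_measure_zero_def using \<open>prob_space \<mu>\<close> id by (rule prob_space.prob_space_distr)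
  show "sets (extend_measure_zero \<mu>) = sets borel"
    by (simp add: extend_measure_zero_def)
  show "(\<integral>\<^sup>+x. h x \<partial>extend_measure_zero \<mu>) = (\<integral>\<^sup>+x. h x \<partial>\<mu>)" if "h \<in> borel_measurable borel" for h
    unfolding extend_measure_zero_def using id that by (subst nn_integral_distr) auto
qed

lemma stochastic_kernelD:
  assumes "stochastic_kernel M K" "x \<in> space M"
  shows "prob_space (K x)" "sets (K x) = sets M"
  using measurable_space[of K M "prob_algebra M" x] assms
  by (auto simp: stochastic_kernel_def space_prob_algebra)

lemma stochastic_kernel_subprob:
  "stochastic_kernel M K \<Longrightarrow> K \<in> measurable M (subprob_algebra M)"
  by (auto simp: stochastic_kernel_def measurable_prob_algebraD)

lemma nn_integral_kernel_measurable:
  assumes "stochastic_kernel M K" "f \<in> borel_measurable M"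
  shows "(\<lambda>x. \<integral>\<^sup>+y. f y \<partial>K x) \<in> borel_measurable M"
  using nn_integral_measurable_subprob_algebra[OF assms(2)]
  by (rule measurable_compose[OF stochastic_kernel_subprob[OF assms(1)]])

text \<open>Integrating the drift inequality against \<mu> makes the two integrals of
  \<open>g\<close> cancel by stationarity. Cancellation is legitimate because \<mu> lives where
  \<open>g \<le> n\<close>, yet the resulting bound is free of \<open>n\<close>.\<close>

lemma nn_integral_drift_le:
  fixes P :: "'a::metric_space \<Rightarrow> 'a measure"
  assumes P: "stochastic_kernel borel P"
    and g: "g \<in> borel_measurable borel" "\<And>x. 0 \<le> g x"
    and r: "r \<in> borel_measurable borel" and b: "0 \<le> b"
    and drift: "\<And>x. (\<integral>\<^sup>+y. ennreal (g y) \<partial>P x) + ennreal (r x) \<le> ennreal (g x + b)"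
    and Q: "general_augmentation P (sublevel g n) Q"
    and \<mu>: "\<mu> \<in> stationary_distributions (restrict_space borel (sublevel g n)) Q"
  shows "(\<integral>\<^sup>+x. ennreal (r x) \<partial>\<mu>) \<le> ennreal b"
proof -
  let ?A = "sublevel g n" and ?R = "restrict_space borel (sublevel g n)"
  have Qk: "stochastic_kernel ?R Q"
    and le: "\<And>x B. x \<in> ?A \<Longrightarrow> B \<in> sets ?R \<Longrightarrow> emeasure (P x) B \<le> emeasure (Q x) B"
    using Q by (auto simp: general_augmentation_def)
  have "prob_space \<mu>" and \<mu>s: "sets \<mu> = sets ?R"
    using \<mu> by (auto simp: stationary_distributions_def space_prob_algebra)
  interpret prob_space \<mu> by fact
  have space: "space \<mu> = ?A" "space ?R = ?A"
    using sets_eq_imp_space_eq[OF \<mu>s] by (auto simp: space_restrict_space)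
  have meas: "h \<in> borel_measurable \<mu>" if "h \<in> borel_measurable borel" for h :: "'a \<Rightarrow> ennreal"
    unfolding measurable_cong_sets[OF \<mu>s refl] using that by (rule measurable_restrict_space1)
  have gm: "(\<lambda>y. ennreal (g y)) \<in> borel_measurable borel"
    and rm: "(\<lambda>y. ennreal (r y)) \<in> borel_measurable borel"
    using g r by measurable
  have "(\<integral>\<^sup>+x. ennreal (g x) \<partial>\<mu>) = (\<integral>\<^sup>+x. \<integral>\<^sup>+y. ennreal (g y) \<partial>Q x \<partial>\<mu>)"
    using Qk \<mu> measurable_restrict_space1[OF gm] by (rule nn_integral_stationary)
  also have "\<dots> \<le> (\<integral>\<^sup>+x. \<integral>\<^sup>+y. ennreal (g y) \<partial>P x \<partial>\<mu>)"
  proof (rule nn_integral_mono)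
    fix x assume "x \<in> space \<mu>"
    then have x: "x \<in> ?A" "x \<in> space ?R" by (simp_all add: space)
    show "(\<integral>\<^sup>+y. ennreal (g y) \<partial>Q x) \<le> (\<integral>\<^sup>+y. ennreal (g y) \<partial>P x)"
      by (rule nn_integral_augmentation_sublevel_le[where c="real n" and A="?A"])
        (use stochastic_kernelD[OF P, of x] stochastic_kernelD[OF Qk x(2)] g le[OF x(1)] in
          \<open>auto simp: sublevel_def\<close>)
  qed
  finally have "(\<integral>\<^sup>+x. ennreal (g x) \<partial>\<mu>) + (\<integral>\<^sup>+x. ennreal (r x) \<partial>\<mu>)
      \<le> (\<integral>\<^sup>+x. \<integral>\<^sup>+y. ennreal (g y) \<partial>P x \<partial>\<mu>) + (\<integral>\<^sup>+x. ennreal (r x) \<partial>\<mu>)"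
    by (rule add_right_mono)
  also have "\<dots> = (\<integral>\<^sup>+x. (\<integral>\<^sup>+y. ennreal (g y) \<partial>P x) + ennreal (r x) \<partial>\<mu>)"
    by (rule nn_integral_add[symmetric]; rule meas; rule nn_integral_kernel_measurable[OF P gm] rm)
  also have "\<dots> \<le> (\<integral>\<^sup>+x. ennreal (g x) + ennreal b \<partial>\<mu>)"
    using drift g b by (intro nn_integral_mono) (simp add: ennreal_plus)
  also have "\<dots> = (\<integral>\<^sup>+x. ennreal (g x) \<partial>\<mu>) + ennreal b"
    by (subst nn_integral_add) (auto simp: meas gm emeasure_space_1)
  finally have "(\<integral>\<^sup>+x. ennreal (g x) \<partial>\<mu>) + (\<integral>\<^sup>+x. ennreal (r x) \<partial>\<mu>)
      \<le> (\<integral>\<^sup>+x. ennreal (g x) \<partial>\<mu>) + ennreal b" .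
  moreover have "(\<integral>\<^sup>+x. ennreal (g x) \<partial>\<mu>) < \<top>"
  proof -
    have "(\<integral>\<^sup>+x. ennreal (g x) \<partial>\<mu>) \<le> (\<integral>\<^sup>+x. ennreal (real n) \<partial>\<mu>)"
      by (intro nn_integral_mono ennreal_leI) (simp add: space sublevel_def)
    also have "\<dots> < \<top>" by (simp add: emeasure_space_1)
    finally show ?thesis .
  qed
  ultimately show ?thesis by auto
qed

text \<open>Stationarity under \<open>Q\<close> becomes approximate stationarity under
  \<open>P\<close>, with the escaping mass as error. That mass is at most 1 off \<open>K\<close> and
  of order \<open>1 / n\<close> on \<open>K\<close>, where \<open>g\<close> is bounded, so
  \<open>K\<close> can be fixed before \<open>n\<close> tends to infinity.\<close>

lemma integral_kernel_augmentation_le: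
  fixes P :: "'a::metric_space \<Rightarrow> 'a measure" and f :: "'a \<Rightarrow> real"
  assumes P: "stochastic_kernel borel P"
    and g: "g \<in> borel_measurable borel" "\<And>x. 0 \<le> g x" and b: "0 \<le> b"
    and drift: "\<And>x. (\<integral>\<^sup>+y. ennreal (g y) \<partial>P x) \<le> ennreal (g x + b)"
    and n: "1 \<le> n" and Q: "general_augmentation P (sublevel g n) Q"
    and \<mu>: "\<mu> \<in> stationary_distributions (restrict_space borel (sublevel g n)) Q"
    and f: "f \<in> borel_measurable borel" "\<And>x. 0 \<le> f x" "\<And>x. f x \<le> 1"
    and K: "K \<in> sets borel" "\<And>x. x \<in> K \<Longrightarrow> g x \<le> C" "0 \<le> C"
  defines "\<nu> \<equiv> extend_measure_zero \<mu>"
  shows "(\<integral>x. \<integral>y. f y \<partial>P x \<partial>\<nu>) \<le> (\<integral>x. f x \<partial>\<nu>) + measure \<nu> (- K) + (C + b) / real n"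
proof -
  let ?A = "sublevel g n" and ?R = "restrict_space borel (sublevel g n)"
  have A: "?A \<in> sets borel" using g(1) unfolding sublevel_def by measurable
  have Qk: "stochastic_kernel ?R Q"
    and le: "\<And>x B. x \<in> ?A \<Longrightarrow> B \<in> sets ?R \<Longrightarrow> emeasure (P x) B \<le> emeasure (Q x) B"
    using Q by (auto simp: general_augmentation_def)
  have \<mu>p: "\<mu> \<in> space (prob_algebra ?R)"
    using \<mu> by (simp add: stationary_distributions_def)
  then have \<mu>s: "sets \<mu> = sets ?R"
    by (simp add: space_prob_algebra)
  note ext = extend_measure_zero_prob[OF \<mu>p, folded \<nu>_def]
  interpret \<nu>: prob_space \<nu> by (rule ext)
  have space: "space \<mu> = ?A" "space ?R = ?A"
    using sets_eq_imp_space_eq[OF \<mu>s] by (auto simp: space_restrict_space)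
  have meas: "h \<in> borel_measurable \<mu>" if "h \<in> borel_measurable borel" for h :: "'a \<Rightarrow> ennreal"
    unfolding measurable_cong_sets[OF \<mu>s refl] using that by (rule measurable_restrict_space1)
  have fm: "(\<lambda>y. ennreal (f y)) \<in> borel_measurable borel"
    using f by measurable
  have Pp: "prob_space (P x)" "sets (P x) = sets borel" for x
    using stochastic_kernelD[OF P, of x] by auto
  have Pf: "(\<integral>\<^sup>+y. ennreal (f y) \<partial>P x) = ennreal (\<integral>y. f y \<partial>P x)" for x
  proof -
    interpret P: prob_space "P x" by (rule Pp)
    have "integrable (P x) f"
      using f Pp(2) by (intro P.integrable_const_bound[where B=1]) (auto cong: measurable_cong_sets)
    then show ?thesis using f by (intro nn_integral_eq_integral) auto
  qed
  have Pf01: "0 \<le> (\<integral>y. f y \<partial>P x)" "(\<integral>y. f y \<partial>P x) \<le> 1" for x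
  proof -
    interpret P: prob_space "P x" by (rule Pp)
    show "0 \<le> (\<integral>y. f y \<partial>P x)" using f by simp
    have "f \<in> borel_measurable (P x)"
      using f Pp(2) by (simp cong: measurable_cong_sets)
    with f show "(\<integral>y. f y \<partial>P x) \<le> 1"
      by (intro P.integral_le_const P.integrable_const_bound[where B=1]) auto
  qed
  have Pfm: "(\<lambda>x. \<integral>y. f y \<partial>P x) \<in> borel_measurable borel"
    using measurable_compose[OF stochastic_kernel_subprob[OF P] integral_measurable_subprob_algebra[OF f(1)]] .
  \<comment> \<open>On \<open>K\<close> this is Markov's inequality for \<open>g\<close> at level
    \<open>n\<close>, with \<open>C + b\<close> bounding the integral of \<open>g\<close>; off
    \<open>K\<close> the trivial bound 1 is used.\<close>
  have escape: "emeasure (P x) (- ?A) \<le> indicator (- K) x + ennreal ((C + b) / real n)" for x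
  proof (cases "x \<in> K")
    case False
    interpret P: prob_space "P x" by (rule Pp)
    have "emeasure (P x) (- ?A) \<le> 1" by (rule P.emeasure_le_1)
    with False show ?thesis by (simp add: add_increasing2)
  next
    case True
    have "ennreal (real n) * emeasure (P x) (- ?A) = (\<integral>\<^sup>+y. ennreal (real n) * indicator (- ?A) y \<partial>P x)"
      using A Pp(2) by (intro nn_integral_cmult_indicator[symmetric]) auto
    also have "\<dots> \<le> (\<integral>\<^sup>+y. ennreal (g y) \<partial>P x)"
      by (intro nn_integral_mono) (auto simp: indicator_def sublevel_def intro: ennreal_leI)
    also have "\<dots> \<le> ennreal (C + b)"
      using K(2)[OF True] by (intro order_trans[OF drift] ennreal_leI) simp
    also have "\<dots> = ennreal (real n) * ennreal ((C + b) / real n)"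
      using n b K(3) by (simp flip: ennreal_mult)
    finally have "emeasure (P x) (- ?A) \<le> ennreal ((C + b) / real n)"
      using n by (simp add: ennreal_mult_le_mult_iff)
    then show ?thesis by (simp add: add_increasing)
  qed
  have escape_meas: "(\<lambda>x. indicator (- K) x + ennreal ((C + b) / real n)) \<in> borel_measurable borel"
    using K by (intro borel_measurable_add borel_measurable_indicator) auto
  have Km: "- K \<in> sets \<nu>" using K ext(2) by auto
  have "ennreal (\<integral>x. \<integral>y. f y \<partial>P x \<partial>\<nu>) = (\<integral>\<^sup>+x. ennreal (\<integral>y. f y \<partial>P x) \<partial>\<nu>)"
    using Pf01 Pfm ext(2)
    by (intro nn_integral_eq_integral[symmetric] \<nu>.integrable_const_bound[where B=1])
      (auto cong: measurable_cong_sets)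
  also have "\<dots> = (\<integral>\<^sup>+x. \<integral>\<^sup>+y. ennreal (f y) \<partial>P x \<partial>\<mu>)"
    using Pfm by (subst ext(3)) (auto simp: Pf)
  also have "\<dots> \<le> (\<integral>\<^sup>+x. (\<integral>\<^sup>+y. ennreal (f y) \<partial>Q x) + emeasure (P x) (- ?A) \<partial>\<mu>)"
  proof (rule nn_integral_mono)
    fix x assume "x \<in> space \<mu>"
    then have x: "x \<in> ?A" "x \<in> space ?R" by (simp_all add: space)
    show "(\<integral>\<^sup>+y. ennreal (f y) \<partial>P x) \<le> (\<integral>\<^sup>+y. ennreal (f y) \<partial>Q x) + emeasure (P x) (- ?A)"
      using Pp(2) A stochastic_kernelD(2)[OF Qk x(2)] le[OF x(1)] fm
      by (rule nn_integral_le_augmentation) (use f in auto)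
  qed
  also have "\<dots> \<le> (\<integral>\<^sup>+x. (\<integral>\<^sup>+y. ennreal (f y) \<partial>Q x) + (indicator (- K) x + ennreal ((C + b) / real n)) \<partial>\<mu>)"
    by (intro nn_integral_mono add_left_mono escape)
  also have "\<dots> = (\<integral>\<^sup>+x. \<integral>\<^sup>+y. ennreal (f y) \<partial>Q x \<partial>\<mu>) + (\<integral>\<^sup>+x. indicator (- K) x + ennreal ((C + b) / real n) \<partial>\<mu>)"
  proof (rule nn_integral_add)
    show "(\<lambda>x. \<integral>\<^sup>+y. ennreal (f y) \<partial>Q x) \<in> borel_measurable \<mu>"
      unfolding measurable_cong_sets[OF \<mu>s refl]
      using Qk measurable_restrict_space1[OF fm] by (rule nn_integral_kernel_measurable)
    show "(\<lambda>x. indicator (- K) x + ennreal ((C + b) / real n)) \<in> borel_measurable \<mu>"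
      by (rule meas) (rule escape_meas)
  qed
  also have "(\<integral>\<^sup>+x. \<integral>\<^sup>+y. ennreal (f y) \<partial>Q x \<partial>\<mu>) = (\<integral>\<^sup>+x. ennreal (f x) \<partial>\<mu>)"
    using Qk \<mu> measurable_restrict_space1[OF fm] by (rule nn_integral_stationary[symmetric])
  also have "\<dots> = (\<integral>\<^sup>+x. ennreal (f x) \<partial>\<nu>)"
    using fm by (rule ext(3)[symmetric])
  also have "\<dots> = ennreal (\<integral>x. f x \<partial>\<nu>)"
    using f ext(2) by (intro nn_integral_eq_integral \<nu>.integrable_const_bound[where B=1])
      (auto cong: measurable_cong_sets)
  also have "(\<integral>\<^sup>+x. indicator (- K) x + ennreal ((C + b) / real n) \<partial>\<mu>)
      = (\<integral>\<^sup>+x. indicator (- K) x + ennreal ((C + b) / real n) \<partial>\<nu>)"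
    by (rule ext(3)[symmetric]) (rule escape_meas)
  also have "\<dots> = ennreal (measure \<nu> (- K)) + ennreal ((C + b) / real n)"
    using Km by (subst nn_integral_add) (auto simp: \<nu>.emeasure_eq_measure \<nu>.prob_space)
  also have "ennreal (\<integral>x. f x \<partial>\<nu>) + (ennreal (measure \<nu> (- K)) + ennreal ((C + b) / real n))
      = ennreal ((\<integral>x. f x \<partial>\<nu>) + measure \<nu> (- K) + (C + b) / real n)"
    using f K(3) b by (simp add: ennreal_plus add.assoc)
  finally show ?thesis
    using f K(3) b by (subst (asm) ennreal_le_iff) auto
qed

section \<open>Convergence of the stationary distributions\<close>

theorem theorem4:
  fixes P :: "'a::polish_space \<Rightarrow> 'a measure"
    and \<pi> :: "'a measure"
    and r g :: "'a \<Rightarrow> real"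
    and b :: real
    and Pn :: "nat \<Rightarrow> 'a \<Rightarrow> 'a measure"
    and \<pi>n :: "nat \<Rightarrow> 'a measure"
  assumes kernel: "stochastic_kernel borel P"
    and stationary: "\<pi> \<in> stationary_distributions borel P"
    and unique: "\<And>\<mu>. \<mu> \<in> stationary_distributions borel P \<Longrightarrow> \<mu> = \<pi>"
    and r_measurable: "r \<in> borel_measurable borel"
    and r_coercive: "coercive r"
    and g_continuous: "continuous_on UNIV g"
    and g_nonneg: "\<And>x. 0 \<le> g x"
    and drift: "\<And>x. enn2ereal (\<integral>\<^sup>+y. ennreal (g y) \<partial>P x) \<le> ereal (g x - r x + b)"
    and weakly_continuous: "weakly_continuous_kernel P"
    and augmentation: "\<And>n. n \<ge> 1 \<Longrightarrow> general_augmentation P (sublevel g n) (Pn n)"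
    and nonempty: "\<And>n. n \<ge> 1 \<Longrightarrow>
          stationary_distributions (restrict_space borel (sublevel g n)) (Pn n) \<noteq> {}"
    and \<pi>n_stationary: "\<And>n. n \<ge> 1 \<Longrightarrow>
          \<pi>n n \<in> stationary_distributions (restrict_space borel (sublevel g n)) (Pn n)"
  shows "converges_weakly (\<lambda>n. extend_measure_zero (\<pi>n n)) \<pi>"
proof -
  \<comment> \<open>The sign of \<open>b\<close> is unknown. Enlarging it to its absolute value and
    moving \<open>r\<close> to the left gives a drift inequality in nonnegative extended reals
    without subtraction.\<close>
  define c where "c = \<bar>b\<bar>"
  have c: "0 \<le> c" by (simp add: c_def)
  have r_nonneg: "0 \<le> r x" for x
    using r_coercive by (simp add: coercive_def)
  have gm: "g \<in> borel_measurable borel"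
    using g_continuous by (rule borel_measurable_continuous_onI)
  have drift': "(\<integral>\<^sup>+y. ennreal (g y) \<partial>P x) + ennreal (r x) \<le> ennreal (g x + c)" for x
  proof (cases "\<integral>\<^sup>+y. ennreal (g y) \<partial>P x")
    case (real i)
    with drift[of x] have "i + r x \<le> g x + c" by (simp add: c_def)
    with real r_nonneg[of x] show ?thesis
      by (simp add: ennreal_leI flip: ennreal_plus)
  next
    \<comment> \<open>The real bound on the right of \<open>drift\<close> excludes an infinite
      integral.\<close>
    case top
    with drift[of x] show ?thesis by simp
  qed
  then have drift_g: "(\<integral>\<^sup>+y. ennreal (g y) \<partial>P x) \<le> ennreal (g x + c)" for x
    by (rule order_trans[rotated]) simp

  \<comment> \<open>Uniform tightness\<close>
  define \<nu> where "\<nu> n = extend_measure_zero (\<pi>n n)" for n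
  have \<pi>n_prob: "\<pi>n n \<in> space (prob_algebra (restrict_space borel (sublevel g n)))" if "1 \<le> n" for n
    using \<pi>n_stationary[OF that] by (simp add: stationary_distributions_def)
  note \<nu> = extend_measure_zero_prob[OF \<pi>n_prob, folded \<nu>_def]
  have tight: "\<exists>K. compact K \<and> (\<forall>n\<ge>1. measure (\<nu> n) (- K) \<le> e)" if "0 < e" for e
  proof -
    obtain k where k: "c / e < real k"
      using reals_Archimedean2 by blast
    have "0 \<le> c / e" using c \<open>0 < e\<close> by simp
    \<comment> \<open>Coercivity speaks only of levels from 1 on. Markov's inequality for
      \<open>r\<close> at level \<open>k\<close> then bounds the mass by \<open>c / k\<close>, which
      is less than \<open>e\<close>.\<close>
    with k have k1: "1 \<le> k" by (cases k) auto
    define K where "K = sublevel r k"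
    have "compact K"
      using r_coercive k1 by (auto simp: coercive_def K_def)
    moreover have "measure (\<nu> n) (- K) \<le> e" if n: "1 \<le> n" for n
    proof -
      interpret prob_space "\<nu> n" by (rule \<nu>(1)[OF n])
      have Km: "- K \<in> sets (\<nu> n)"
        using \<open>compact K\<close> \<nu>(2)[OF n] by (simp add: borel_closed compact_imp_closed borel_comp)
      have "ennreal (real k * measure (\<nu> n) (- K)) = ennreal (real k) * emeasure (\<nu> n) (- K)"
        by (simp add: emeasure_eq_measure ennreal_mult)
      also have "\<dots> = (\<integral>\<^sup>+x. ennreal (real k) * indicator (- K) x \<partial>\<nu> n)"
        using Km by (rule nn_integral_cmult_indicator[symmetric])
      also have "\<dots> \<le> (\<integral>\<^sup>+x. ennreal (r x) \<partial>\<nu> n)"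
        by (intro nn_integral_mono) (auto simp: indicator_def K_def sublevel_def intro: ennreal_leI)
      also have "\<dots> = (\<integral>\<^sup>+x. ennreal (r x) \<partial>\<pi>n n)"
        using r_measurable by (intro \<nu>(3)[OF n]) measurable
      also have "\<dots> \<le> ennreal c"
        by (rule nn_integral_drift_le[OF kernel gm g_nonneg r_measurable c drift'
              augmentation[OF n] \<pi>n_stationary[OF n]])
      finally have "real k * measure (\<nu> n) (- K) \<le> c"
        using c by simp
      also have "\<dots> \<le> real k * e"
        using k \<open>0 < e\<close> by (simp add: field_simps)
      finally show ?thesis using k1 by simp
    qed
    ultimately show ?thesis by blast
  qed

  \<comment> \<open>Stationarity of all weak cluster points\<close>
  have limit_stationary: "\<mu> = \<pi>"
    if G: "G \<le> sequentially" "G \<noteq> bot" and \<mu>: "sets \<mu> = sets borel" "prob_space \<mu>"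
      and lim: "\<And>f::'a \<Rightarrow> real. continuous_on UNIV f \<Longrightarrow> bounded (range f) \<Longrightarrow>
        ((\<lambda>n. \<integral>x. f x \<partial>\<nu> n) \<longlongrightarrow> (\<integral>x. f x \<partial>\<mu>)) G"
    for G \<mu>
  proof -
    interpret \<mu>: prob_space \<mu> by fact
    have Pp: "prob_space (P x)" "sets (P x) = sets borel" for x
      using stochastic_kernelD[OF kernel, of x] by auto
    have Psub: "P \<in> measurable \<mu> (subprob_algebra borel)"
      unfolding measurable_cong_sets[OF \<mu>(1) refl] using kernel by (rule stochastic_kernel_subprob)
    have le: "(\<integral>x. \<integral>y. f y \<partial>P x \<partial>\<mu>) \<le> (\<integral>x. f x \<partial>\<mu>)"
      if f: "continuous_on UNIV f" "\<And>x. 0 \<le> f x" "\<And>x. f x \<le> 1" for f :: "'a \<Rightarrow> real"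
    proof (rule field_le_epsilon)
      fix e :: real assume "0 < e"
      \<comment> \<open>One compact \<open>K\<close> serves all \<open>n\<close>, so the bound
        \<open>C\<close> of \<open>g\<close> on \<open>K\<close> is fixed and
        \<open>(C + c) / n\<close> vanishes along \<open>G\<close>.\<close>
      then obtain K where K: "compact K" "\<And>n. 1 \<le> n \<Longrightarrow> measure (\<nu> n) (- K) \<le> e"
        using tight by blast
      have "bounded (g ` K)"
        using K(1) g_continuous by (intro compact_imp_bounded compact_continuous_image)
          (auto intro: continuous_on_subset)
      then obtain C' where C': "\<And>x. x \<in> K \<Longrightarrow> g x \<le> C'"
        unfolding bounded_iff by (metis abs_le_iff imageI real_norm_def)
      define C where "C = max C' 0"
      have C: "\<And>x. x \<in> K \<Longrightarrow> g x \<le> C" "0 \<le> C"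
        using C' by (auto simp: C_def le_max_iff_disj)
      have fm: "f \<in> borel_measurable borel"
        using f(1) by (rule borel_measurable_continuous_onI)
      have fb: "bounded (range f)"
        unfolding bounded_iff using f by (intro exI[of _ 1]) auto
      \<comment> \<open>Weak continuity makes this an admissible test function, so the left-hand
        integrals converge along \<open>G\<close> too.\<close>
      have Pf: "continuous_on UNIV (\<lambda>x. \<integral>y. f y \<partial>P x)" "bounded (range (\<lambda>x. \<integral>y. f y \<partial>P x))"
        using weakly_continuous f(1) fb by (auto simp: weakly_continuous_kernel_def)
      have "((\<lambda>n. (C + c) / real n) \<longlongrightarrow> 0) G"
        using G(1) by (rule tendsto_mono) (rule lim_const_over_n)
      then have "((\<lambda>n. (\<integral>x. f x \<partial>\<nu> n) + e + (C + c) / real n) \<longlongrightarrow> (\<integral>x. f x \<partial>\<mu>) + e + 0) G"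
        by (intro tendsto_add tendsto_const lim f fb)
      moreover have "\<forall>\<^sub>F n in G. (\<integral>x. \<integral>y. f y \<partial>P x \<partial>\<nu> n) \<le> (\<integral>x. f x \<partial>\<nu> n) + e + (C + c) / real n"
      proof -
        have "\<forall>\<^sub>F n in G. 1 \<le> n"
          using G(1) eventually_ge_at_top by (auto simp: le_filter_def)
        then show ?thesis
        proof eventually_elim
          case (elim n)
          have Kb: "K \<in> sets borel"
            using K(1) by (simp add: borel_closed compact_imp_closed)
          show ?case
            using integral_kernel_augmentation_le[OF kernel gm g_nonneg c drift_g elim
                augmentation[OF elim] \<pi>n_stationary[OF elim] fm f(2,3) Kb C] K(2)[OF elim]
            by (simp add: \<nu>_def)
        qed
      qed
      ultimately have "(\<integral>x. \<integral>y. f y \<partial>P x \<partial>\<mu>) \<le> (\<integral>x. f x \<partial>\<mu>) + e + 0"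
        using lim[OF Pf] by (intro tendsto_le[OF G(2)])
      then show "(\<integral>x. \<integral>y. f y \<partial>P x \<partial>\<mu>) \<le> (\<integral>x. f x \<partial>\<mu>) + e" by simp
    qed
    have "\<mu> = \<mu> \<bind> P"
    proof (rule prob_measure_eqI_continuous)
      show "prob_space (\<mu> \<bind> P)"
        using Pp(1) by (intro \<mu>.prob_space_bind[OF _ Psub]) auto
      show "sets (\<mu> \<bind> P) = sets borel"
        by (rule sets_bind[OF sets_kernel[OF Psub] \<mu>.not_empty])
      fix f :: "'a \<Rightarrow> real"
      assume f: "continuous_on UNIV f" "\<And>x. 0 \<le> f x" "\<And>x. f x \<le> 1"
      have fm: "f \<in> borel_measurable borel"
        using f(1) by (rule borel_measurable_continuous_onI)
      have int: "integrable N f" if "prob_space N" "sets N = sets borel" for N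
      proof -
        interpret prob_space N by fact
        show ?thesis
          using f(2,3) fm that(2)
          by (intro integrable_const_bound[where B=1]) (auto cong: measurable_cong_sets)
      qed
      have Pf_int: "integrable \<mu> (\<lambda>x. \<integral>y. f y \<partial>P x)"
      proof (rule \<mu>.integrable_const_bound[where B=1])
        show "(\<lambda>x. \<integral>y. f y \<partial>P x) \<in> borel_measurable \<mu>"
          using Psub integral_measurable_subprob_algebra[OF fm] by (rule measurable_compose)
        have "0 \<le> (\<integral>y. f y \<partial>P x) \<and> (\<integral>y. f y \<partial>P x) \<le> 1" for x
        proof -
          interpret P: prob_space "P x" by (rule Pp)
          show ?thesis
            using f by (auto intro!: P.integral_le_const int Pp)
        qed
        then show "AE x in \<mu>. norm (\<integral>y. f y \<partial>P x) \<le> 1" by simp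
      qed
      have compl: "(\<integral>y. 1 - f y \<partial>N) = 1 - (\<integral>y. f y \<partial>N)" if "prob_space N" "sets N = sets borel" for N
      proof -
        interpret prob_space N by fact
        show ?thesis using int[OF that] by (simp add: prob_space)
      qed
      \<comment> \<open>All measures involved have mass 1, so the one-sided bound for
        \<open>1 - f\<close> is the reverse bound for \<open>f\<close>.\<close>
      have "(\<integral>x. \<integral>y. 1 - f y \<partial>P x \<partial>\<mu>) \<le> (\<integral>x. 1 - f x \<partial>\<mu>)"
        using f by (intro le continuous_intros) auto
      then have "(\<integral>x. f x \<partial>\<mu>) \<le> (\<integral>x. \<integral>y. f y \<partial>P x \<partial>\<mu>)"
        using Pf_int by (simp add: compl Pp \<mu> \<mu>.prob_space)
      moreover have "(\<integral>x. \<integral>y. f y \<partial>P x \<partial>\<mu>) \<le> (\<integral>x. f x \<partial>\<mu>)"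
        using f by (rule le)
      moreover have "(\<integral>x. f x \<partial>(\<mu> \<bind> P)) = (\<integral>x. \<integral>y. f y \<partial>P x \<partial>\<mu>)"
        using fm _ Psub \<mu>.finite_measure_axioms
      proof (rule integral_bind[where B=1 and B'=1])
        show "\<bar>f x\<bar> \<le> 1" for x using f(2,3)[of x] by simp
        show "AE x in \<mu>. emeasure (P x) (space (P x)) \<le> ennreal 1"
          using Pp(1) by (simp add: prob_space.emeasure_space_1)
      qed
      ultimately show "(\<integral>x. f x \<partial>\<mu>) = (\<integral>x. f x \<partial>(\<mu> \<bind> P))" by simp
    qed (fact \<mu>)+
    then have "emeasure \<mu> B = (\<integral>\<^sup>+x. emeasure (P x) B \<partial>\<mu>)" if "B \<in> sets borel" for B
      using emeasure_bind[OF \<mu>.not_empty Psub that] by simp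
    with \<mu> have "\<mu> \<in> stationary_distributions borel P"
      by (simp add: stationary_distributions_def space_prob_algebra)
    then show "\<mu> = \<pi>" by (rule unique)
  qed

  \<comment> \<open>From cluster points to convergence\<close>
  show ?thesis
    unfolding converges_weakly_def \<nu>_def[symmetric]
  proof (intro allI impI, elim conjE)
    fix f :: "'a \<Rightarrow> real"
    assume f: "continuous_on UNIV f" "bounded (range f)"
    show "(\<lambda>n. \<integral>x. f x \<partial>\<nu> n) \<longlonglongrightarrow> (\<integral>x. f x \<partial>\<pi>)"
    proof (rule ccontr)
      assume "\<not> ?thesis"
      then obtain e where e: "0 < e"
        and "\<not> (\<forall>\<^sub>F n in sequentially. dist (\<integral>x. f x \<partial>\<nu> n) (\<integral>x. f x \<partial>\<pi>) < e)"
        unfolding tendsto_iff by blast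
      \<comment> \<open>\<open>F\<close> confines the tails to the indices at which the integrals
        stay at distance at least \<open>e\<close>. It is proper since such indices recur, and a
        cluster point along it must be \<pi>, contradicting that distance.\<close>
      define F where "F = inf sequentially (principal {n. \<not> dist (\<integral>x. f x \<partial>\<nu> n) (\<integral>x. f x \<partial>\<pi>) < e})"
      have "F \<noteq> bot"
        using \<open>\<not> (\<forall>\<^sub>F n in sequentially. _)\<close>
        unfolding F_def trivial_limit_def eventually_inf_principal by simp
      have F: "F \<le> sequentially" by (simp add: F_def)
      have ev1: "\<forall>\<^sub>F n in F. 1 \<le> n"
        using F eventually_ge_at_top by (auto simp: le_filter_def)
      have prob_F: "\<forall>\<^sub>F n in F. prob_space (\<nu> n) \<and> sets (\<nu> n) = sets borel"
        using ev1 by eventually_elim (simp add: \<nu>)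
      have tight_F: "\<exists>K. compact K \<and> (\<forall>\<^sub>F n in F. measure (\<nu> n) (- K) \<le> d)" if "0 < d" for d
      proof -
        obtain K where K: "compact K" "\<And>n. 1 \<le> n \<Longrightarrow> measure (\<nu> n) (- K) \<le> d"
          using tight[OF \<open>0 < d\<close>] by blast
        have "\<forall>\<^sub>F n in F. measure (\<nu> n) (- K) \<le> d"
          using ev1 by eventually_elim (rule K(2))
        with K(1) show ?thesis by blast
      qed
      show False
      proof (rule tight_imp_weakly_convergent_subfilter[OF \<open>F \<noteq> bot\<close> prob_F tight_F])
        fix G \<mu>
        assume G: "G \<le> F" "G \<noteq> bot" and \<mu>: "sets \<mu> = sets borel" "prob_space \<mu>"
          and lim: "\<And>f::'a \<Rightarrow> real. continuous_on UNIV f \<Longrightarrow> bounded (range f) \<Longrightarrow>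
            ((\<lambda>n. \<integral>x. f x \<partial>\<nu> n) \<longlongrightarrow> (\<integral>x. f x \<partial>\<mu>)) G"
        have "\<mu> = \<pi>"
          using order_trans[OF G(1) F] G(2) \<mu> lim by (rule limit_stationary)
        with lim[OF f] e have "\<forall>\<^sub>F n in G. dist (\<integral>x. f x \<partial>\<nu> n) (\<integral>x. f x \<partial>\<pi>) < e"
          by (simp add: tendsto_iff)
        moreover have "\<forall>\<^sub>F n in F. \<not> dist (\<integral>x. f x \<partial>\<nu> n) (\<integral>x. f x \<partial>\<pi>) < e"
          unfolding F_def eventually_inf_principal by simp
        then have "\<forall>\<^sub>F n in G. \<not> dist (\<integral>x. f x \<partial>\<nu> n) (\<integral>x. f x \<partial>\<pi>) < e"
          using G(1) by (simp add: le_filter_def)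
        ultimately have "\<forall>\<^sub>F n in G. False"
          by eventually_elim simp
        with G(2) show False by (simp add: trivial_limit_def)
      qed
    qed
  qed
qed

end
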